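(* Let $\mathcal{D}$, $\Xi$, $\mathcal{F}$, $\mathcal{X}(z,\xi)$ and $\mathcal{Q}$ be as in the context. The two-stage distributionally robust problem $$\min_{z \in \mathcal{F}} \ q^{T} z + \sup_{\mathbb{P} \in \mathcal{D}} \mathbb{E}_{\mathbb{P}}\big[ \mathcal{Q}(z, \tilde{\xi}) \big]$$ is equivalent to the min-max-min problem $$\min_{z \in \mathcal{F},\ \lambda_E \in \mathbb{R},\ \lambda_N \in \mathbb{R}} \ q^{T} z + \mu_E \lambda_E + \mu_N \lambda_N + \Big\{ \max_{\xi=(\xi_E,\xi_N) \in \Xi} \ \Big( \min_{x \in \mathcal{X}(z,\xi)} c^{T} x \Big) - \lambda_E \xi_E - \lambda_N \xi_N \Big\}.$$
   Context: $R$ is the radius of the half-disk support set $$\Xi = \{ \xi=(\xi_E,\xi_N)\in\mathbb{R}^2 : -R\le \xi_E\le R,\ 0\le \xi_N\le R,\ \xi_E^2+\xi_N^2\le R^2\}.$$ Mean values $(\mu_E,\mu_N)$ are given. The mean-support ambiguity set $\mathcal{D}$ is the set of all probability distributions $\mathbb{P}$ of a random vector $\tilde{\xi}=(\tilde{\xi}_E,\tilde{\xi}_N)$ with $\mathbb{P}\{\tilde{\xi}\in\Xi\}=1$, $\mathbb{E}_{\mathbb{P}}[\tilde{\xi}_E]=\mu_E$ and $\mathbb{E}_{\mathbb{P}}[\tilde{\xi}_N]=\mu_N$. $z$ is the first-stage decision vector, $\mathcal{F}$ is the first-stage feasible region (that of a mixed-integer second-order cone program), and $q$ is a cost vector. The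 second-stage problem is a linear program, and $\mathcal{Q}(z,\xi)$ denotes its optimal value: $$\mathcal{Q}(z,\xi)=\min_{x\in\mathcal{X}(z,\xi)} c^{T}x,\qquad \mathcal{X}(z,\xi)=\{x\in\mathbb{R}^n : A x + B(\xi) z \ge d\},$$ where $c\in\mathbb{R}^n$, $A\in\mathbb{R}^{m\times n}$, $d\in\mathbb{R}^m$, and $B(\xi)$ is a matrix with $m$ rows whose entries are affine functions of $\xi$.
   Formalization: The formal theorem assumes R > 0 and that either the second-stage LP is feasible for all z in F and ξ in Ξ, or the mean is interior to Ξ; otherwise the two values can differ. Min over λ is an infimum, shown attained when the mean is interior. *)

theory Defs
  imports "HOL-Probability.Probability"
begin

text \<open>Points of the plane are pairs \<open>\<xi> = (\<xi>\<^sub>E, \<xi>\<^sub>N)\<close>.\<close>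

definition half_disk :: "real \<Rightarrow> (real \<times> real) set" where
  "half_disk R = {(\<xi>\<^sub>E, \<xi>\<^sub>N). - R \<le> \<xi>\<^sub>E \<and> \<xi>\<^sub>E \<le> R \<and> 0 \<le> \<xi>\<^sub>N \<and> \<xi>\<^sub>N \<le> R \<and> \<xi>\<^sub>E\<^sup>2 + \<xi>\<^sub>N\<^sup>2 \<le> R\<^sup>2}"

text \<open>Both coordinates are integrable under every measure below, since the support is bounded;
  the Bochner integrals are therefore genuine means.\<close>

definition ambiguity_set :: "real \<Rightarrow> real \<Rightarrow> real \<Rightarrow> (real \<times> real) measure set" where
  "ambiguity_set R \<mu>\<^sub>E \<mu>\<^sub>N =
     {P. prob_space P \<and> sets P = sets borel \<and> measure P (half_disk R) = 1 \<and>
         (\<integral>\<xi>. fst \<xi> \<partial>P) = \<mu>\<^sub>E \<and> (\<integral>\<xi>. snd \<xi> \<partial>P) = \<mu>\<^sub>N}"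

text \<open>Expectation of an extended-real function: integral of the positive part minus integral of the
  negative part (\<open>e2ennreal\<close> sends negative values to 0). In \<open>ereal\<close>, \<open>\<infinity> - \<infinity> = \<infinity>\<close>, the usual
  convention for minimization problems.\<close>

definition ext_expectation :: "'a measure \<Rightarrow> ('a \<Rightarrow> ereal) \<Rightarrow> ereal" where
  "ext_expectation M f =
     enn2ereal (\<integral>\<^sup>+x. e2ennreal (f x) \<partial>M) - enn2ereal (\<integral>\<^sup>+x. e2ennreal (- f x) \<partial>M)"

lemma ext_expectation_ereal:
  assumes "integrable M f"
  shows "ext_expectation M (\<lambda>x. ereal (f x)) = ereal (\<integral>x. f x \<partial>M)"
  using assms by (elim integrableE) (simp add: ext_expectation_def)

definition affine_entries :: "(real \<times> real \<Rightarrow> real ^ 'k ^ 'm) \<Rightarrow> bool" where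
  "affine_entries B \<longleftrightarrow>
     (\<forall>i j. \<exists>b\<^sub>0 b\<^sub>E b\<^sub>N. \<forall>\<xi>. B \<xi> $ i $ j = b\<^sub>0 + b\<^sub>E * fst \<xi> + b\<^sub>N * snd \<xi>)"

text \<open>The order on vectors is componentwise.\<close>

definition second_stage_feasible ::
  "real ^ 'n ^ 'm \<Rightarrow> (real \<times> real \<Rightarrow> real ^ 'k ^ 'm) \<Rightarrow> real ^ 'm \<Rightarrow> real ^ 'k \<Rightarrow> real \<times> real
    \<Rightarrow> (real ^ 'n) set" where
  "second_stage_feasible A B d z \<xi> = {x. A *v x + B \<xi> *v z \<ge> d}"

text \<open>Optimal value of the linear program, \<open>\<infinity>\<close> if it is infeasible and \<open>-\<infinity>\<close> if it is unbounded.\<close>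

definition second_stage_value ::
  "real ^ 'n \<Rightarrow> real ^ 'n ^ 'm \<Rightarrow> (real \<times> real \<Rightarrow> real ^ 'k ^ 'm) \<Rightarrow> real ^ 'm \<Rightarrow> real ^ 'k
    \<Rightarrow> real \<times> real \<Rightarrow> ereal" where
  "second_stage_value c A B d z \<xi> = (INF x \<in> second_stage_feasible A B d z \<xi>. ereal (c \<bullet> x))"

definition dro_objective ::
  "real ^ 'k \<Rightarrow> (real \<times> real) measure set \<Rightarrow> (real ^ 'k \<Rightarrow> real \<times> real \<Rightarrow> ereal) \<Rightarrow> real ^ 'k
    \<Rightarrow> ereal" where
  "dro_objective q \<D> Q z = ereal (q \<bullet> z) + (SUP P \<in> \<D>. ext_expectation P (Q z))"

text \<open>The multipliers \<open>l\<^sub>E, l\<^sub>N\<close> are the mathematical lambdas (reserved as a token here). Optimal values are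
  infima and suprema in \<open>ereal\<close>: if the mean lies on the boundary of the support, the infimum over
  the multipliers need not be attained.\<close>

definition dual_integrand ::
  "(real ^ 'k \<Rightarrow> real \<times> real \<Rightarrow> ereal) \<Rightarrow> real ^ 'k \<Rightarrow> real \<Rightarrow> real \<Rightarrow> real \<times> real \<Rightarrow> ereal" where
  "dual_integrand Q z l\<^sub>E l\<^sub>N \<xi> = Q z \<xi> - ereal (l\<^sub>E * fst \<xi>) - ereal (l\<^sub>N * snd \<xi>)"

definition minmaxmin_objective ::
  "real ^ 'k \<Rightarrow> real \<Rightarrow> real \<Rightarrow> (real \<times> real) set \<Rightarrow> (real ^ 'k \<Rightarrow> real \<times> real \<Rightarrow> ereal)
    \<Rightarrow> real ^ 'k \<Rightarrow> real \<Rightarrow> real \<Rightarrow> ereal" where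
  "minmaxmin_objective q \<mu>\<^sub>E \<mu>\<^sub>N \<Xi> Q z l\<^sub>E l\<^sub>N =
     ereal (q \<bullet> z + \<mu>\<^sub>E * l\<^sub>E + \<mu>\<^sub>N * l\<^sub>N) + (SUP \<xi> \<in> \<Xi>. dual_integrand Q z l\<^sub>E l\<^sub>N \<xi>)"

end

theory Submission imports Defs begin

text \<open>
  Fix \<open>z\<close>. The epigraph of the value function of a linear program, seen as a function of the
  right-hand side, is a finitely generated cone, hence a polyhedron. So on the right-hand sides for
  which the program is feasible, the value is either \<open>- \<infinity>\<close> throughout or a maximum of finitely many
  affine functions. Consequently \<open>Q z\<close> is continuous on the half-disk if it is finite, although
  convexity alone would not give upper semicontinuity at the curved boundary.

  For a continuous \<open>g\<close> on the compact convex support, the attainable pairs (mean, expectation of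
  \<open>g\<close>) contain the compact convex hull of the graph of \<open>g\<close>. Let \<open>v\<close> be the largest value of this
  hull above \<open>\<mu>\<close>. Separating the hull from the ray above \<open>(\<mu>, t)\<close>, \<open>t > v\<close>, gives a non-vertical
  hyperplane, that is, multipliers with dual value at most \<open>t\<close>; if \<open>\<mu>\<close> is interior, \<open>t = v\<close> is
  possible. If some point of the support is infeasible, then \<open>\<mu>\<close> is interior, some admissible
  distribution charges this point, and both sides are \<open>\<infinity>\<close>.
\<close>

section \<open>Convex hulls as barycentres of finitely supported distributions\<close>

text \<open>Such barycentres include the points of \<open>S\<close> (point masses) and form a convex
  set (toss a coin of bias \<open>u\<close>, then draw from \<open>p\<close> or \<open>r\<close>),
  so they fill the hull.\<close>

lemma convex_hull_imp_pmf_expectation: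
  fixes S :: "'a::euclidean_space set"
  assumes "x \<in> convex hull S"
  obtains p where "finite (set_pmf p)" "set_pmf p \<subseteq> S" "measure_pmf.expectation p (\<lambda>y. y) = x"
proof -
  define T where "T = {x. \<exists>p. finite (set_pmf p) \<and> set_pmf p \<subseteq> S \<and> measure_pmf.expectation p (\<lambda>y. y) = x}"
  have "S \<subseteq> T"
  proof
    fix y assume "y \<in> S"
    then show "y \<in> T"
      unfolding T_def by (intro CollectI exI[of _ "return_pmf y"]) auto
  qed
  moreover have "convex T"
  proof (rule convexI)
    fix x y and u v :: real
    assume "x \<in> T" "y \<in> T" and uv: "0 \<le> u" "0 \<le> v" "u + v = 1"
    then obtain p r where
      p: "finite (set_pmf p)" "set_pmf p \<subseteq> S" "measure_pmf.expectation p (\<lambda>y. y) = x" and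
      r: "finite (set_pmf r)" "set_pmf r \<subseteq> S" "measure_pmf.expectation r (\<lambda>y. y) = y"
      unfolding T_def by blast
    have v: "1 - u = v" using uv by simp
    define w where "w = bernoulli_pmf u \<bind> (\<lambda>b. if b then p else r)"
    have "measure_pmf.expectation w (\<lambda>y. y) =
        (\<Sum>b\<in>UNIV. pmf (bernoulli_pmf u) b *\<^sub>R measure_pmf.expectation (if b then p else r) (\<lambda>y. y))"
      unfolding w_def by (rule pmf_expectation_bind) (use p r in auto)
    also have "\<dots> = u *\<^sub>R x + v *\<^sub>R y"
      using uv p r by (simp add: UNIV_bool add.commute flip: v)
    finally have "measure_pmf.expectation w (\<lambda>y. y) = u *\<^sub>R x + v *\<^sub>R y" .
    moreover have "set_pmf w \<subseteq> set_pmf p \<union> set_pmf r"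
      by (auto simp: w_def split: if_splits)
    ultimately show "u *\<^sub>R x + v *\<^sub>R y \<in> T"
      unfolding T_def using p r by (intro CollectI exI[of _ w]) (auto intro: finite_subset)
  qed
  ultimately have "convex hull S \<subseteq> T"
    by (rule hull_minimal)
  with assms that show ?thesis
    unfolding T_def by blast
qed

section \<open>The value of a linear program as a function of its right-hand side\<close>

lemma polyhedron_linear_program_epigraph:
  fixes A :: "real ^ 'n ^ 'm" and c :: "real ^ 'n"
  shows "polyhedron {(h, t). \<exists>x. A *v x \<ge> h \<and> c \<bullet> x \<le> t}" (is "polyhedron ?E")
proof -
  \<comment> \<open>The set is the cone generated by the columns of \<open>(A, c)\<close> with both signs, the slacks
    \<open>(- e\<^sub>i, 0)\<close> and \<open>(0, 1)\<close>; a finitely generated cone is a polyhedron.\<close>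
  define g where "g x = (A *v x, c \<bullet> x)" for x
  have "linear g"
    unfolding g_def by (intro linearI) (auto simp: algebra_simps matrix_vector_mult_scaleR inner_simps)
  define S where "S = range (\<lambda>j. g (axis j 1)) \<union> range (\<lambda>j. - g (axis j 1))
    \<union> range (\<lambda>i. (- axis i 1, 0)) \<union> {(0, 1)}"
  define D where "D = convex_cone hull S"
  have S: "s \<in> D" if "s \<in> S" for s
    unfolding D_def using that by (rule hull_inc)
  have add: "x + y \<in> D" if "x \<in> D" "y \<in> D" for x y
    using that unfolding D_def by (rule convex_cone_hull_add)
  have mul: "a *\<^sub>R x \<in> D" if "x \<in> D" "a \<ge> 0" for x a
    using that unfolding D_def by (rule convex_cone_hull_mul)
  have sum: "(\<Sum>i\<in>I. f i) \<in> D" if "finite I" "\<And>i. i \<in> I \<Longrightarrow> f i \<in> D" for I :: "'i set" and f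
    using that
  proof (induction I)
    case empty
    show ?case by (simp add: D_def convex_cone_hull_contains_0)
  qed (simp add: add)
  have "?E = D"
  proof
    have "convex_cone ?E"
      unfolding convex_cone_iff
    proof (intro conjI ballI allI impI)
      show "0 \<in> ?E" by (auto simp: zero_prod_def intro!: exI[of _ 0])
    next
      fix p r assume "p \<in> ?E" "r \<in> ?E"
      then obtain x y where "A *v x \<ge> fst p" "c \<bullet> x \<le> snd p" "A *v y \<ge> fst r" "c \<bullet> y \<le> snd r"
        by auto
      then show "p + r \<in> ?E"
        by (auto simp: plus_prod_def matrix_vector_right_distrib inner_simps intro!: exI[of _ "x + y"] add_mono)
    next
      fix p and a :: real assume "p \<in> ?E" "a \<ge> 0"
      then obtain x where "A *v x \<ge> fst p" "c \<bullet> x \<le> snd p"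
        by auto
      with \<open>a \<ge> 0\<close> show "a *\<^sub>R p \<in> ?E"
        by (auto simp: scaleR_prod_def matrix_vector_mult_scaleR less_eq_vec_def
            intro!: exI[of _ "a *\<^sub>R x"] mult_left_mono)
    qed
    moreover have "S \<subseteq> ?E"
    proof -
      have "\<exists>x. A *v x \<ge> - (A *v axis j 1) \<and> c \<bullet> x \<le> - (c \<bullet> axis j 1)" for j
        using linear_neg[OF \<open>linear g\<close>, of "axis j 1"]
        by (intro exI[of _ "- axis j 1"]) (simp add: g_def)
      then show ?thesis
        by (auto simp: S_def g_def less_eq_vec_def axis_def intro: exI[of _ 0])
    qed
    ultimately show "D \<subseteq> ?E"
      unfolding D_def by (intro hull_minimal)
  next
    show "?E \<subseteq> D"
    proof clarify
      fix h t x assume x: "A *v x \<ge> h" "c \<bullet> x \<le> t"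
      have "g x = (\<Sum>j\<in>UNIV. x $ j *\<^sub>R g (axis j 1))"
        using \<open>linear g\<close> by (subst basis_expansion[of x, symmetric])
          (simp add: linear_sum linear_scale scalar_mult_eq_scaleR)
      also have "\<dots> \<in> D"
      proof (rule sum)
        fix j :: 'n
        show "x $ j *\<^sub>R g (axis j 1) \<in> D"
        \<comment> \<open>A cone admits only nonnegative weights, so the sign of
          \<open>x $ j\<close> selects one of the two opposite generators.\<close>
        proof (cases "x $ j \<ge> 0")
          case True
          then show ?thesis by (intro mul S) (auto simp: S_def)
        next
          case False
          then have "(- x $ j) *\<^sub>R - g (axis j 1) \<in> D"
            by (intro mul S) (auto simp: S_def)
          then show ?thesis by simp
        qed
      qed simp
      finally have "g x \<in> D" .
      \<comment> \<open>The slack generators, with weights \<open>A *v x - h\<close> and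
        \<open>t - c \<bullet> x\<close>, move \<open>g x\<close> to \<open>(h, t)\<close>.\<close>
      moreover have "(\<Sum>i\<in>UNIV. (A *v x - h) $ i *\<^sub>R (- axis i 1, 0)) \<in> D"
        using x by (intro sum mul S) (auto simp: S_def less_eq_vec_def)
      moreover have "(t - c \<bullet> x) *\<^sub>R (0, 1) \<in> D"
        using x by (intro mul S) (auto simp: S_def)
      moreover have "(\<Sum>i\<in>UNIV. (A *v x - h) $ i *\<^sub>R (- axis i 1, 0::real)) = (h - A *v x, 0)"
        using basis_expansion[of "h - A *v x"]
        by (auto simp: prod_eq_iff fst_sum snd_sum scalar_mult_eq_scaleR algebra_simps simp flip: sum_subtractf)
      ultimately have "g x + (h - A *v x, 0) + (t - c \<bullet> x) *\<^sub>R (0, 1) \<in> D"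
        by (metis add)
      then show "(h, t) \<in> D"
        by (simp add: g_def)
    qed
  qed
  moreover have "finite S"
    by (simp add: S_def)
  ultimately show ?thesis
    unfolding D_def by (metis polyhedron_convex_cone_hull)
qed

text \<open>An inequality of the epigraph with a negative coefficient at \<open>t\<close> is a lower
  bound on \<open>t\<close> that is affine in \<open>h\<close>, and the value is the supremum of
  these bounds. \<open>G\<close> is the same for all \<open>h\<close>; \<open>G = {}\<close> encodes
  an unbounded program, since the empty supremum is \<open>- \<infinity>\<close>.\<close>

lemma linear_program_value_polyhedral:
  fixes A :: "real ^ 'n ^ 'm" and c :: "real ^ 'n"
  obtains G :: "((real ^ 'm) \<times> real) set" where "finite G"
    "\<And>h. {x. A *v x \<ge> h} \<noteq> {} \<Longrightarrow>
       (INF x\<in>{x. A *v x \<ge> h}. ereal (c \<bullet> x)) = (SUP (a, b)\<in>G. ereal (a \<bullet> h + b))"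
proof -
  let ?E = "{(h, t). \<exists>x. A *v x \<ge> h \<and> c \<bullet> x \<le> t}"
  obtain \<H> where "finite \<H>" and E: "?E = \<Inter>\<H>" and "\<forall>H\<in>\<H>. \<exists>a b. a \<noteq> 0 \<and> H = {p. a \<bullet> p \<le> b}"
    using polyhedron_linear_program_epigraph[of A c] unfolding polyhedron_def by metis
  then have "\<forall>H\<in>\<H>. \<exists>ab. \<forall>p. p \<in> H \<longleftrightarrow> fst ab \<bullet> p \<le> snd ab"
    by fastforce
  from bchoice[OF this] obtain ab where ab: "\<forall>H\<in>\<H>. \<forall>p. p \<in> H \<longleftrightarrow> fst (ab H) \<bullet> p \<le> snd (ab H)"
    by blast
  define a b where "a H = fst (ab H)" and "b H = snd (ab H)" for H
  have mem: "p \<in> H \<longleftrightarrow> a H \<bullet> p \<le> b H" if "H \<in> \<H>" for H p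
    using ab that unfolding a_def b_def by blast
  have E_iff: "(h, t) \<in> ?E \<longleftrightarrow> (\<forall>H\<in>\<H>. fst (a H) \<bullet> h + snd (a H) * t \<le> b H)" for h t
    unfolding E by (simp add: mem inner_prod_def)
  have nonpos: "snd (a H) \<le> 0" if "H \<in> \<H>" for H
  proof (rule ccontr)
    assume neg: "\<not> snd (a H) \<le> 0"
    \<comment> \<open>The epigraph contains the upward ray from the origin, and this height violates
      the inequality if the coefficient is positive.\<close>
    define t where "t = (\<bar>b H\<bar> + 1) / snd (a H)"
    have "t \<ge> 0" using neg by (simp add: t_def)
    then have "(0, t) \<in> ?E" by (auto intro!: exI[of _ 0])
    then have "snd (a H) * t \<le> b H" using that by (subst (asm) E_iff) auto
    then show False using neg by (simp add: t_def)
  qed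
  define \<H>' where "\<H>' = {H \<in> \<H>. snd (a H) < 0}"
  define G where "G = (\<lambda>H. ((1 / - snd (a H)) *\<^sub>R fst (a H), b H / snd (a H))) ` \<H>'"
  show ?thesis
  proof
    show "finite G" using \<open>finite \<H>\<close> by (simp add: G_def \<H>'_def)
  next
    fix h assume ne: "{x. A *v x \<ge> h} \<noteq> {}"
    then obtain x0 where x0: "A *v x0 \<ge> h" by auto
    then have "(h, c \<bullet> x0) \<in> ?E" by auto
    \<comment> \<open>With coefficient zero the inequality concerns \<open>h\<close> alone, and a
      point of the epigraph above \<open>h\<close> satisfies it.\<close>
    then have flat: "fst (a H) \<bullet> h \<le> b H" if "H \<in> \<H>" "snd (a H) = 0" for H
      using that by (subst (asm) E_iff) force
    have iff: "(h, t) \<in> ?E \<longleftrightarrow> (\<forall>(a, b)\<in>G. a \<bullet> h + b \<le> t)" for t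
    proof -
      have *: "fst (a H) \<bullet> h + snd (a H) * t \<le> b H \<longleftrightarrow>
          ((1 / - snd (a H)) *\<^sub>R fst (a H)) \<bullet> h + b H / snd (a H) \<le> t" if "snd (a H) < 0" for H
        using that by (simp add: field_simps)
      have "(h, t) \<in> ?E \<longleftrightarrow> (\<forall>H\<in>\<H>'. fst (a H) \<bullet> h + snd (a H) * t \<le> b H)"
        unfolding E_iff using nonpos flat by (force simp: \<H>'_def order_le_less)
      then show ?thesis using * by (auto simp: G_def \<H>'_def)
    qed
    have "(SUP (a, b)\<in>G. ereal (a \<bullet> h + b)) \<le> ereal (c \<bullet> x)" if "A *v x \<ge> h" for x
    proof -
      have "(h, c \<bullet> x) \<in> ?E" using that by auto
      then show ?thesis by (subst (asm) iff) (auto intro!: SUP_least)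
    qed
    \<comment> \<open>Comparing real upper bounds \<open>t\<close> covers the value
      \<open>- \<infinity>\<close> as well.\<close>
    moreover have "(INF x\<in>{x. A *v x \<ge> h}. ereal (c \<bullet> x)) \<le> ereal t" if "ereal t \<ge> (SUP (a, b)\<in>G. ereal (a \<bullet> h + b))" for t
    proof -
      have "(h, t) \<in> ?E"
        unfolding iff using that by (auto simp: SUP_le_iff)
      then show ?thesis by (auto intro: INF_lower2)
    qed
    ultimately show "(INF x\<in>{x. A *v x \<ge> h}. ereal (c \<bullet> x)) = (SUP (a, b)\<in>G. ereal (a \<bullet> h + b))"
      by (metis (mono_tags, lifting) INF_greatest antisym ereal_le_real mem_Collect_eq)
  qed
qed

lemma SUP_ereal_continuous:
  fixes f :: "'i \<Rightarrow> 'a::topological_space \<Rightarrow> real"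
  assumes "finite I" "I \<noteq> {}" "\<And>i. i \<in> I \<Longrightarrow> continuous_on S (f i)"
  obtains g where "continuous_on S g" "\<And>x. (SUP i\<in>I. ereal (f i x)) = ereal (g x)"
proof -
  have "\<exists>g. continuous_on S g \<and> (\<forall>x. (SUP i\<in>I. ereal (f i x)) = ereal (g x))"
    using assms
  proof (induction I rule: finite_ne_induct)
    case (singleton i)
    then show ?case by auto
  next
    case (insert i I)
    then obtain g where "continuous_on S g" "\<And>x. (SUP i\<in>I. ereal (f i x)) = ereal (g x)"
      by auto
    with insert show ?case
      by (intro exI[of _ "\<lambda>x. max (f i x) (g x)"]) (auto intro!: continuous_intros simp: sup_max)
  qed
  with that show ?thesis by blast
qed

text \<open>Moving \<open>B \<xi> *v z\<close> to the right leaves \<open>\<xi>\<close> only in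
  \<open>h \<xi>\<close>, which is affine in \<open>\<xi>\<close>. As \<open>G\<close> depends only
  on \<open>A\<close> and \<open>c\<close>, one alternative holds for all feasible
  \<open>\<xi>\<close> at once. The maximum defining \<open>g\<close> makes sense at infeasible
  \<open>\<xi>\<close> too, hence continuity on the whole plane.\<close>

lemma second_stage_value_cases:
  fixes A :: "real ^ 'n ^ 'm" and B :: "real \<times> real \<Rightarrow> real ^ 'k ^ 'm"
  assumes "affine_entries B"
  obtains
    (unbounded) "\<And>\<xi>. second_stage_feasible A B d z \<xi> \<noteq> {} \<Longrightarrow> second_stage_value c A B d z \<xi> = - \<infinity>"
  | (bounded) g where "continuous_on UNIV g"
      "\<And>\<xi>. second_stage_feasible A B d z \<xi> \<noteq> {} \<Longrightarrow> second_stage_value c A B d z \<xi> = ereal (g \<xi>)"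
proof -
  define h where "h \<xi> = d - B \<xi> *v z" for \<xi>
  have "continuous_on UNIV (\<lambda>\<xi>. B \<xi> $ i $ j)" for i j
  proof -
    from assms obtain b\<^sub>0 b\<^sub>E b\<^sub>N where "\<And>\<xi>. B \<xi> $ i $ j = b\<^sub>0 + b\<^sub>E * fst \<xi> + b\<^sub>N * snd \<xi>"
      unfolding affine_entries_def by blast
    then show ?thesis by (auto intro!: continuous_intros)
  qed
  then have "continuous_on UNIV h"
    unfolding h_def matrix_vector_mult_def
    by (intro continuous_on_diff continuous_on_const continuous_on_vec_lambda continuous_on_sum continuous_on_mult)
  have feas: "second_stage_feasible A B d z \<xi> = {x. A *v x \<ge> h \<xi>}" for \<xi>
    by (auto simp: second_stage_feasible_def h_def less_eq_vec_def algebra_simps)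
  obtain G where "finite G" and G: "\<And>h. {x. A *v x \<ge> h} \<noteq> {} \<Longrightarrow>
       (INF x\<in>{x. A *v x \<ge> h}. ereal (c \<bullet> x)) = (SUP (a, b)\<in>G. ereal (a \<bullet> h + b))"
    using linear_program_value_polyhedral[of A c] by metis
  have val: "second_stage_value c A B d z \<xi> = (SUP p\<in>G. ereal (fst p \<bullet> h \<xi> + snd p))"
    if "second_stage_feasible A B d z \<xi> \<noteq> {}" for \<xi>
    using G that by (simp add: second_stage_value_def feas case_prod_beta)
  show ?thesis
  proof (cases "G = {}")
    case True
    with val show ?thesis by (intro unbounded) (simp add: bot_ereal_def)
  next
    case False
    obtain g where "continuous_on UNIV g" "\<And>\<xi>. (SUP p\<in>G. ereal (fst p \<bullet> h \<xi> + snd p)) = ereal (g \<xi>)"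
      by (rule SUP_ereal_continuous[OF \<open>finite G\<close> False, of UNIV "\<lambda>p \<xi>. fst p \<bullet> h \<xi> + snd p"])
        (auto intro!: continuous_intros \<open>continuous_on UNIV h\<close>)
    with val show ?thesis by (intro bounded) auto
  qed
qed

section \<open>The half-disk and the distributions supported on it\<close>

text \<open>The norm of a pair is Euclidean; compactness and convexity can be read off from a closed
  disk cut by a closed half-plane.\<close>

lemma half_disk_eq:
  assumes "R \<ge> 0"
  shows "half_disk R = cball 0 R \<inter> {\<xi>. (0, 1) \<bullet> \<xi> \<ge> 0}"
proof -
  have "(\<xi>\<^sub>E, \<xi>\<^sub>N) \<in> half_disk R \<longleftrightarrow> norm (\<xi>\<^sub>E, \<xi>\<^sub>N) \<le> R \<and> 0 \<le> \<xi>\<^sub>N" for \<xi>\<^sub>E \<xi>\<^sub>N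
  proof -
    have "norm (\<xi>\<^sub>E, \<xi>\<^sub>N) \<le> R \<longleftrightarrow> (norm (\<xi>\<^sub>E, \<xi>\<^sub>N))\<^sup>2 \<le> R\<^sup>2"
      using assms by (simp add: power_mono_iff)
    also have "\<dots> \<longleftrightarrow> \<xi>\<^sub>E\<^sup>2 + \<xi>\<^sub>N\<^sup>2 \<le> R\<^sup>2"
      by (simp add: norm_Pair)
    finally have "norm (\<xi>\<^sub>E, \<xi>\<^sub>N) \<le> R \<longleftrightarrow> \<xi>\<^sub>E\<^sup>2 + \<xi>\<^sub>N\<^sup>2 \<le> R\<^sup>2" .
    moreover have "\<bar>\<xi>\<^sub>E\<bar> \<le> R \<and> \<bar>\<xi>\<^sub>N\<bar> \<le> R" if "norm (\<xi>\<^sub>E, \<xi>\<^sub>N) \<le> R"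
      using that norm_fst_le[of \<xi>\<^sub>E \<xi>\<^sub>N] norm_snd_le[of \<xi>\<^sub>N \<xi>\<^sub>E] by auto
    ultimately show ?thesis
      unfolding half_disk_def by (simp add: abs_le_iff) linarith
  qed
  then show ?thesis by auto
qed

lemma half_disk:
  assumes "R > 0"
  shows compact_half_disk: "compact (half_disk R)" and convex_half_disk: "convex (half_disk R)"
    and half_disk_nonempty: "half_disk R \<noteq> {}" and half_disk_borel: "half_disk R \<in> sets borel"
proof -
  show c: "compact (half_disk R)"
    using assms by (simp add: half_disk_eq compact_Int_closed closed_halfspace_ge)
  show "convex (half_disk R)"
    using assms by (simp add: half_disk_eq convex_Int convex_halfspace_ge)
  have "0 \<in> half_disk R"
    using assms by (simp add: half_disk_eq)
  then show "half_disk R \<noteq> {}" by auto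
  show "half_disk R \<in> sets borel"
    using c by (intro borel_closed compact_imp_closed)
qed

text \<open>Integrability holds because a continuous \<open>g\<close> is bounded on the compact
  support, which has full measure.\<close>

lemma ambiguity_setD:
  assumes "P \<in> ambiguity_set R \<mu>\<^sub>E \<mu>\<^sub>N" "R > 0"
  shows "prob_space P" "AE \<xi> in P. \<xi> \<in> half_disk R"
    and "\<And>g :: real \<times> real \<Rightarrow> real. continuous_on UNIV g \<Longrightarrow> integrable P g"
    and "(\<integral>\<xi>. fst \<xi> \<partial>P) = \<mu>\<^sub>E" "(\<integral>\<xi>. snd \<xi> \<partial>P) = \<mu>\<^sub>N"
proof -
  have P: "prob_space P" "sets P = sets borel" "measure P (half_disk R) = 1"
      "(\<integral>\<xi>. fst \<xi> \<partial>P) = \<mu>\<^sub>E" "(\<integral>\<xi>. snd \<xi> \<partial>P) = \<mu>\<^sub>N"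
    using assms by (auto simp: ambiguity_set_def)
  then interpret prob_space P by simp
  show "prob_space P" "(\<integral>\<xi>. fst \<xi> \<partial>P) = \<mu>\<^sub>E" "(\<integral>\<xi>. snd \<xi> \<partial>P) = \<mu>\<^sub>N"
    by fact+
  show AE: "AE \<xi> in P. \<xi> \<in> half_disk R"
    using P half_disk_borel[OF assms(2)] by (subst prob_eq_1[symmetric]) auto
  fix g :: "real \<times> real \<Rightarrow> real" assume g: "continuous_on UNIV g"
  have "compact (g ` half_disk R)"
    using compact_half_disk[OF assms(2)] g by (intro compact_continuous_image) (auto intro: continuous_on_subset)
  from compact_imp_bounded[OF this] obtain M where M: "\<And>\<xi>. \<xi> \<in> half_disk R \<Longrightarrow> norm (g \<xi>) \<le> M"
    by (auto simp: bounded_iff)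
  have "g \<in> borel_measurable P"
    using borel_measurable_continuous_onI[OF g] by (simp add: measurable_cong_sets[OF P(2) refl])
  moreover have "AE \<xi> in P. norm (g \<xi>) \<le> M"
    using AE by eventually_elim (rule M)
  ultimately show "integrable P g"
    by (intro integrable_const_bound)
qed

text \<open>Passing to the image measure supplies the Borel sigma-algebra required of admissible
  distributions; \<open>measure_pmf p\<close> itself measures all sets.\<close>

lemma distr_pmf_in_ambiguity_set:
  fixes \<phi> :: "'a \<Rightarrow> real \<times> real"
  assumes "R > 0" "finite (set_pmf p)" "\<And>x. x \<in> set_pmf p \<Longrightarrow> \<phi> x \<in> half_disk R"
    and "measure_pmf.expectation p \<phi> = (\<mu>\<^sub>E, \<mu>\<^sub>N)"
  shows "distr (measure_pmf p) borel \<phi> \<in> ambiguity_set R \<mu>\<^sub>E \<mu>\<^sub>N"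
proof -
  have int: "integrable (measure_pmf p) \<phi>"
    using assms(2) by (rule integrable_measure_pmf_finite)
  have "measure (measure_pmf p) (\<phi> -` half_disk R) = 1"
    using assms(3) by (subst measure_pmf.prob_eq_1) (auto simp: AE_measure_pmf_iff)
  then have "measure (distr (measure_pmf p) borel \<phi>) (half_disk R) = 1"
    using half_disk_borel[OF assms(1)] by (simp add: measure_distr)
  moreover have "measure_pmf.expectation p (\<lambda>x. fst (\<phi> x)) = \<mu>\<^sub>E"
    using integral_bounded_linear[OF bounded_linear_fst int] assms(4) by simp
  moreover have "measure_pmf.expectation p (\<lambda>x. snd (\<phi> x)) = \<mu>\<^sub>N"
    using integral_bounded_linear[OF bounded_linear_snd int] assms(4) by simp
  ultimately show ?thesis
    unfolding ambiguity_set_def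
    by (simp add: integral_distr measure_pmf.prob_space_distr borel_measurable_continuous_onI
        continuous_on_fst continuous_on_snd continuous_on_id)
qed

lemma ext_expectation_cong_AE:
  assumes "AE x in M. f x = g x"
  shows "ext_expectation M f = ext_expectation M g"
proof -
  have "(\<integral>\<^sup>+x. e2ennreal (f x) \<partial>M) = (\<integral>\<^sup>+x. e2ennreal (g x) \<partial>M)"
    "(\<integral>\<^sup>+x. e2ennreal (- f x) \<partial>M) = (\<integral>\<^sup>+x. e2ennreal (- g x) \<partial>M)"
    using assms by (auto intro!: nn_integral_cong_AE)
  then show ?thesis by (simp add: ext_expectation_def)
qed

section \<open>Affine majorants from separating hyperplanes\<close>

lemma compact_convex_hull_graph:
  fixes g :: "'a::euclidean_space \<Rightarrow> real"
  assumes "compact K" "continuous_on K g"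
  shows "compact (convex hull ((\<lambda>\<xi>. (\<xi>, g \<xi>)) ` K))"
  using assms by (intro compact_convex_hull compact_continuous_image continuous_intros)

text \<open>Here \<open>v\<close> is the value at \<open>\<mu>\<close> of the concave envelope of
  \<open>g\<close> on \<open>K\<close>, and \<open>l\<close> is the slope of an affine majorant of
  \<open>g\<close> with height \<open>t\<close> at \<open>\<mu>\<close>. Above \<open>v\<close>
  strict separation is available; at \<open>v\<close> only weak separation is, and an interior
  \<open>\<mu>\<close> rules out a vertical hyperplane.\<close>

lemma affine_majorant_at_concave_envelope:
  fixes K :: "'a::euclidean_space set"
  assumes "compact K" "continuous_on K g" "\<mu> \<in> K"
  obtains v where "(\<mu>, v) \<in> convex hull ((\<lambda>\<xi>. (\<xi>, g \<xi>)) ` K)"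
    and "\<And>t. t > v \<Longrightarrow> \<exists>l. \<forall>\<xi>\<in>K. g \<xi> - l \<bullet> \<xi> \<le> t - l \<bullet> \<mu>"
    and "\<mu> \<in> interior K \<Longrightarrow> \<exists>l. \<forall>\<xi>\<in>K. g \<xi> - l \<bullet> \<xi> \<le> v - l \<bullet> \<mu>"
proof -
  define C where "C = convex hull ((\<lambda>\<xi>. (\<xi>, g \<xi>)) ` K)"
  have C: "compact C" "convex C"
    using assms by (simp_all add: C_def compact_convex_hull_graph convex_convex_hull)
  have graph: "(\<xi>, g \<xi>) \<in> C" if "\<xi> \<in> K" for \<xi>
    using that unfolding C_def by (intro hull_inc) auto
  have "compact (snd ` (C \<inter> {\<mu>} \<times> UNIV))"
    using C by (intro compact_continuous_image continuous_intros compact_Int_closed closed_Times) auto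
  moreover have "g \<mu> \<in> snd ` (C \<inter> {\<mu>} \<times> UNIV)"
    using graph[OF assms(3)] by force
  ultimately obtain v where "v \<in> snd ` (C \<inter> {\<mu>} \<times> UNIV)" and
    "\<And>t. t \<in> snd ` (C \<inter> {\<mu>} \<times> UNIV) \<Longrightarrow> t \<le> v"
    by (metis compact_attains_sup empty_iff)
  then have v: "(\<mu>, v) \<in> C" and max: "\<And>t. (\<mu>, t) \<in> C \<Longrightarrow> t \<le> v"
    by force+
  have g_le: "g \<mu> \<le> v"
    using max graph assms(3) by blast
  \<comment> \<open>A separating hyperplane with normal \<open>(a, \<alpha>)\<close>, \<open>\<alpha> > 0\<close>, gives the multiplier \<open>- a / \<alpha>\<close>.\<close>
  have majorant: "\<exists>l. \<forall>\<xi>\<in>K. g \<xi> - l \<bullet> \<xi> \<le> t - l \<bullet> \<mu>"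
    if "\<alpha> > 0" "\<And>\<xi>. \<xi> \<in> K \<Longrightarrow> a \<bullet> \<xi> + \<alpha> * g \<xi> \<le> b" "b \<le> a \<bullet> \<mu> + \<alpha> * t" for a \<alpha> b t
  proof (intro exI ballI)
    fix \<xi> assume "\<xi> \<in> K"
    then have "\<alpha> * (g \<xi> - t) \<le> a \<bullet> \<mu> - a \<bullet> \<xi>"
      using that(2)[of \<xi>] that(3) by (simp add: algebra_simps)
    then have "g \<xi> - t \<le> (a \<bullet> \<mu> - a \<bullet> \<xi>) / \<alpha>"
      using that(1) by (simp add: pos_le_divide_eq mult.commute)
    then show "g \<xi> - (- (a /\<^sub>R \<alpha>)) \<bullet> \<xi> \<le> t - (- (a /\<^sub>R \<alpha>)) \<bullet> \<mu>"
      by (simp add: diff_divide_distrib divide_inverse algebra_simps)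
  qed
  show ?thesis
  proof
    show "(\<mu>, v) \<in> convex hull ((\<lambda>\<xi>. (\<xi>, g \<xi>)) ` K)"
      using v by (simp add: C_def)
  next
    fix t assume "t > v"
    have "C \<inter> {\<mu>} \<times> {t..} = {}"
      using max \<open>t > v\<close> by force
    moreover have "closed ({\<mu>} \<times> {t..})" "convex ({\<mu>} \<times> {t..})"
      by (auto intro!: closed_Times convex_Times)
    ultimately obtain p b where p: "\<forall>x\<in>C. p \<bullet> x < b" "\<forall>x\<in>{\<mu>} \<times> {t..}. p \<bullet> x > b"
      using separating_hyperplane_compact_closed[of C "{\<mu>} \<times> {t..}"] C v by blast
    obtain a \<alpha> where [simp]: "p = (a, \<alpha>)" by (cases p)
    have below: "a \<bullet> \<xi> + \<alpha> * g \<xi> < b" if "\<xi> \<in> K" for \<xi>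
      using p graph[OF that] by force
    have above: "b < a \<bullet> \<mu> + \<alpha> * t"
      using p by simp
    \<comment> \<open>The points \<open>(\<mu>, g \<mu>)\<close> and \<open>(\<mu>, t)\<close> lie
      on opposite sides and differ only in height, which fixes the sign of
      \<open>\<alpha>\<close>.\<close>
    have "\<alpha> * (t - g \<mu>) > 0"
      using below[OF assms(3)] above by (simp add: algebra_simps)
    then have "\<alpha> > 0"
      using g_le \<open>t > v\<close> by (simp add: zero_less_mult_iff)
    then show "\<exists>l. \<forall>\<xi>\<in>K. g \<xi> - l \<bullet> \<xi> \<le> t - l \<bullet> \<mu>"
      by (rule majorant[of \<alpha> a b]) (use below above in \<open>auto intro: less_imp_le\<close>)
  next
    assume int: "\<mu> \<in> interior K"
    \<comment> \<open>The ray omits its endpoint because \<open>(\<mu>, v)\<close> belongs to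
      \<open>C\<close>.\<close>
    have "C \<inter> {\<mu>} \<times> {v<..} = {}"
      using max by force
    moreover have "convex ({\<mu>} \<times> {v<..})" "{\<mu>} \<times> {v<..} \<noteq> {}"
      by (auto intro!: convex_Times)
    ultimately obtain p b where "p \<noteq> 0" and p: "\<forall>x\<in>C. p \<bullet> x \<le> b" "\<forall>x\<in>{\<mu>} \<times> {v<..}. p \<bullet> x \<ge> b"
      using separating_hyperplane_sets[of C "{\<mu>} \<times> {v<..}"] C v by blast
    obtain a \<alpha> where [simp]: "p = (a, \<alpha>)" by (cases p)
    have below: "a \<bullet> \<xi> + \<alpha> * g \<xi> \<le> b" if "\<xi> \<in> K" for \<xi>
      using p graph[OF that] by force
    have above: "b \<le> a \<bullet> \<mu> + \<alpha> * s" if "s > v" for s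
      using p that by simp
    have "\<alpha> * (v + 1 - g \<mu>) \<ge> 0"
      using below[OF assms(3)] above[of "v + 1"] by (simp add: algebra_simps)
    then have "\<alpha> \<ge> 0"
      using g_le by (simp add: zero_le_mult_iff)
    moreover have "\<alpha> \<noteq> 0"
    proof
      assume "\<alpha> = 0"
      then have "a \<noteq> 0" using \<open>p \<noteq> 0\<close> by (simp add: zero_prod_def)
      obtain e where e: "e > 0" "cball \<mu> e \<subseteq> K"
        using int by (auto simp: mem_interior_cball)
      \<comment> \<open>A step of length \<open>e\<close> along \<open>a\<close> stays in
        \<open>K\<close> but leaves the half-space
        \<open>a \<bullet> \<xi> \<le> a \<bullet> \<mu>\<close> to which a vertical hyperplane
        would confine \<open>K\<close>.\<close>
      define \<xi> where "\<xi> = \<mu> + (e / norm a) *\<^sub>R a"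
      have "\<xi> \<in> K"
        using e \<open>a \<noteq> 0\<close> by (auto simp: \<xi>_def dist_norm intro!: subsetD[OF e(2)])
      then have "a \<bullet> \<xi> \<le> a \<bullet> \<mu>"
        using below above[of "v + 1"] \<open>\<alpha> = 0\<close> by fastforce
      then have "(e / norm a) * (a \<bullet> a) \<le> 0"
        by (simp add: \<xi>_def inner_simps)
      moreover have "(e / norm a) * (a \<bullet> a) > 0"
        using e \<open>a \<noteq> 0\<close> by (intro mult_pos_pos divide_pos_pos) auto
      ultimately show False by simp
    qed
    ultimately have "\<alpha> > 0" by simp
    have "(b - a \<bullet> \<mu>) / \<alpha> \<le> v"
    proof (rule dense_ge)
      fix s assume "s > v"
      then show "(b - a \<bullet> \<mu>) / \<alpha> \<le> s"
        using above[of s] \<open>\<alpha> > 0\<close> by (simp add: pos_divide_le_eq algebra_simps)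
    qed
    then have "b \<le> a \<bullet> \<mu> + \<alpha> * v"
      using \<open>\<alpha> > 0\<close> by (simp add: pos_divide_le_eq algebra_simps)
    with \<open>\<alpha> > 0\<close> below show "\<exists>l. \<forall>\<xi>\<in>K. g \<xi> - l \<bullet> \<xi> \<le> v - l \<bullet> \<mu>"
      by (rule majorant)
  qed
qed

text \<open>If \<open>a\<close> separates \<open>\<mu>\<close> from \<open>K\<close>, the affine
  function of slope \<open>- s *\<^sub>R a\<close> and height \<open>t\<close> at
  \<open>\<mu>\<close> rises towards \<open>K\<close>; for large \<open>s\<close> it is at least the
  bound \<open>M\<close> of \<open>g\<close> there, however low \<open>t\<close> is.\<close>

lemma affine_majorant_outside:
  fixes K :: "'a::euclidean_space set" and g :: "'a \<Rightarrow> real"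
  assumes "compact K" "convex K" "K \<noteq> {}" "continuous_on K g" "\<mu> \<notin> K"
  shows "\<exists>l. \<forall>\<xi>\<in>K. g \<xi> - l \<bullet> \<xi> \<le> t - l \<bullet> \<mu>"
proof -
  obtain a b where ab: "\<forall>\<xi>\<in>K. a \<bullet> \<xi> < b" "b < a \<bullet> \<mu>"
    using separating_hyperplane_compact_closed[of K "{\<mu>}"] assms by auto
  obtain M where M: "\<And>\<xi>. \<xi> \<in> K \<Longrightarrow> g \<xi> \<le> M"
    using continuous_attains_sup[OF assms(1,3,4)] by blast
  define s where "s = \<bar>M - t\<bar> / (a \<bullet> \<mu> - b)"
  have "s \<ge> 0" "M - t \<le> s * (a \<bullet> \<mu> - b)"
    using ab by (auto simp: s_def)
  show ?thesis
  proof (intro exI ballI)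
    fix \<xi> assume "\<xi> \<in> K"
    then have "s * (a \<bullet> \<xi>) \<le> s * b"
      using ab \<open>s \<ge> 0\<close> by (intro mult_left_mono) (auto intro: less_imp_le)
    with M[OF \<open>\<xi> \<in> K\<close>] \<open>M - t \<le> _\<close> show "g \<xi> - (- s *\<^sub>R a) \<bullet> \<xi> \<le> t - (- s *\<^sub>R a) \<bullet> \<mu>"
      by (simp add: algebra_simps)
  qed
qed

section \<open>Comparing expectations with dual objective values\<close>

text \<open>Values of \<open>f\<close> off the support, possibly infinite, carry no mass.\<close>

lemma ext_expectation_ambiguity_set:
  assumes "R > 0" "P \<in> ambiguity_set R \<mu>\<^sub>E \<mu>\<^sub>N" "continuous_on UNIV g"
    and "\<And>\<xi>. \<xi> \<in> half_disk R \<Longrightarrow> f \<xi> = ereal (g \<xi>)"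
  shows "ext_expectation P f = ereal (\<integral>\<xi>. g \<xi> \<partial>P)"
proof -
  have "AE \<xi> in P. f \<xi> = ereal (g \<xi>)"
    using ambiguity_setD(2)[OF assms(2,1)] by eventually_elim (rule assms(4))
  then have "ext_expectation P f = ext_expectation P (\<lambda>\<xi>. ereal (g \<xi>))"
    by (rule ext_expectation_cong_AE)
  also have "\<dots> = ereal (\<integral>\<xi>. g \<xi> \<partial>P)"
    by (intro ext_expectation_ereal ambiguity_setD(3)[OF assms(2,1)] assms)
  finally show ?thesis .
qed

text \<open>When \<open>k\<close> is bounded by its maximum on the support and integrated, the mean
  constraints turn the linear terms into constants. For an empty ambiguity set the left side is
  \<open>- \<infinity>\<close>.\<close>

lemma weak_duality:
  assumes "R > 0" "continuous_on UNIV g"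
    and "\<And>\<xi>. \<xi> \<in> half_disk R \<Longrightarrow> Q z \<xi> = ereal (g \<xi>)"
  shows "dro_objective q (ambiguity_set R \<mu>\<^sub>E \<mu>\<^sub>N) Q z
    \<le> minmaxmin_objective q \<mu>\<^sub>E \<mu>\<^sub>N (half_disk R) Q z l\<^sub>E l\<^sub>N"
proof -
  define k where "k \<xi> = g \<xi> - l\<^sub>E * fst \<xi> - l\<^sub>N * snd \<xi>" for \<xi>
  have k: "continuous_on UNIV k"
    unfolding k_def using assms(2) by (intro continuous_intros)
  obtain \<xi>m where \<xi>m: "\<xi>m \<in> half_disk R" "\<And>\<xi>. \<xi> \<in> half_disk R \<Longrightarrow> k \<xi> \<le> k \<xi>m"
    using continuous_attains_sup[OF compact_half_disk half_disk_nonempty, of R k] assms(1) k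
      continuous_on_subset by blast
  have "ext_expectation P (Q z) \<le> ereal (\<mu>\<^sub>E * l\<^sub>E + \<mu>\<^sub>N * l\<^sub>N + k \<xi>m)"
    if P: "P \<in> ambiguity_set R \<mu>\<^sub>E \<mu>\<^sub>N" for P
  proof -
    note D = ambiguity_setD[OF P assms(1)]
    interpret prob_space P by (rule D)
    have int: "integrable P g" "integrable P fst" "integrable P snd" "integrable P k"
      using assms(2) k by (auto intro!: D(3) continuous_intros)
    have "AE \<xi> in P. k \<xi> \<le> k \<xi>m"
      using D(2) by eventually_elim (rule \<xi>m)
    then have "(\<integral>\<xi>. k \<xi> \<partial>P) \<le> k \<xi>m"
      using int(4) by (intro integral_le_const)
    moreover have "(\<integral>\<xi>. k \<xi> \<partial>P) = (\<integral>\<xi>. g \<xi> \<partial>P) - l\<^sub>E * \<mu>\<^sub>E - l\<^sub>N * \<mu>\<^sub>N"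
      unfolding k_def using int D(4,5) by simp
    ultimately show ?thesis
      using ext_expectation_ambiguity_set[OF assms(1) P assms(2), of "Q z"] assms(3)
      by (simp add: algebra_simps)
  qed
  then have "(SUP P \<in> ambiguity_set R \<mu>\<^sub>E \<mu>\<^sub>N. ext_expectation P (Q z))
      \<le> ereal (\<mu>\<^sub>E * l\<^sub>E + \<mu>\<^sub>N * l\<^sub>N) + ereal (k \<xi>m)"
    by (auto intro: SUP_least)
  also have "ereal (k \<xi>m) \<le> (SUP \<xi>\<in>half_disk R. dual_integrand Q z l\<^sub>E l\<^sub>N \<xi>)"
    using \<xi>m(1) assms(3) by (intro SUP_upper2[OF \<xi>m(1)]) (simp add: dual_integrand_def k_def)
  finally show ?thesis
    unfolding dro_objective_def minmaxmin_objective_def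
    by (simp add: add.assoc add_left_mono add_mono flip: plus_ereal.simps(1))
qed

text \<open>The linear terms cancel at the mean, so a majorant of height \<open>t\<close> there
  costs at most \<open>t\<close> beyond \<open>q \<bullet> z\<close>.\<close>

lemma minmaxmin_objective_le:
  assumes "\<And>\<xi>. \<xi> \<in> \<Xi> \<Longrightarrow> Q z \<xi> = ereal (g \<xi>)"
    and "\<And>\<xi>. \<xi> \<in> \<Xi> \<Longrightarrow> g \<xi> - l \<bullet> \<xi> \<le> t - l \<bullet> (\<mu>\<^sub>E, \<mu>\<^sub>N)"
  shows "minmaxmin_objective q \<mu>\<^sub>E \<mu>\<^sub>N \<Xi> Q z (fst l) (snd l) \<le> ereal (q \<bullet> z + t)"
proof -
  have "dual_integrand Q z (fst l) (snd l) \<xi> \<le> ereal (t - l \<bullet> (\<mu>\<^sub>E, \<mu>\<^sub>N))" if "\<xi> \<in> \<Xi>" for \<xi>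
    using assms that by (simp add: dual_integrand_def inner_prod_def diff_diff_eq)
  then have "(SUP \<xi>\<in>\<Xi>. dual_integrand Q z (fst l) (snd l) \<xi>) \<le> ereal (t - l \<bullet> (\<mu>\<^sub>E, \<mu>\<^sub>N))"
    by (rule SUP_least)
  then have "minmaxmin_objective q \<mu>\<^sub>E \<mu>\<^sub>N \<Xi> Q z (fst l) (snd l)
      \<le> ereal (q \<bullet> z + \<mu>\<^sub>E * fst l + \<mu>\<^sub>N * snd l) + ereal (t - l \<bullet> (\<mu>\<^sub>E, \<mu>\<^sub>N))"
    unfolding minmaxmin_objective_def by (rule add_left_mono)
  also have "\<dots> = ereal (q \<bullet> z + t)"
    by (simp add: inner_prod_def algebra_simps)
  finally show ?thesis .
qed

text \<open>A point of the hull is the barycentre of a finitely supported distribution on the graph.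
  Projecting this distribution to the plane gives an admissible one under which \<open>g\<close> has
  expectation \<open>v\<close>, as heights on the graph are values of \<open>g\<close>.\<close>

lemma dro_objective_ge_envelope:
  assumes "R > 0" "continuous_on UNIV g"
    and "\<And>\<xi>. \<xi> \<in> half_disk R \<Longrightarrow> Q z \<xi> = ereal (g \<xi>)"
    and "((\<mu>\<^sub>E, \<mu>\<^sub>N), v) \<in> convex hull ((\<lambda>\<xi>. (\<xi>, g \<xi>)) ` half_disk R)"
  shows "ereal (q \<bullet> z + v) \<le> dro_objective q (ambiguity_set R \<mu>\<^sub>E \<mu>\<^sub>N) Q z"
proof -
  obtain p where p: "finite (set_pmf p)" "set_pmf p \<subseteq> (\<lambda>\<xi>. (\<xi>, g \<xi>)) ` half_disk R"
    "measure_pmf.expectation p (\<lambda>y. y) = ((\<mu>\<^sub>E, \<mu>\<^sub>N), v)"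
    using convex_hull_imp_pmf_expectation[OF assms(4)] by metis
  define P where "P = distr (measure_pmf p) borel fst"
  have int: "integrable (measure_pmf p) (\<lambda>y. y)"
    using p(1) by (rule integrable_measure_pmf_finite)
  have "measure_pmf.expectation p fst = (\<mu>\<^sub>E, \<mu>\<^sub>N)"
    using integral_bounded_linear[OF bounded_linear_fst int] p(3) by simp
  then have P: "P \<in> ambiguity_set R \<mu>\<^sub>E \<mu>\<^sub>N"
    unfolding P_def using assms(1) p by (intro distr_pmf_in_ambiguity_set) auto
  have "(\<integral>\<xi>. g \<xi> \<partial>P) = measure_pmf.expectation p (\<lambda>y. g (fst y))"
    unfolding P_def using assms(2) by (intro integral_distr) (auto intro: borel_measurable_continuous_onI)
  also have "\<dots> = measure_pmf.expectation p snd"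
    using p(2) by (intro integral_cong_AE) (auto simp: AE_measure_pmf_iff)
  also have "\<dots> = v"
    using integral_bounded_linear[OF bounded_linear_snd int] p(3) by simp
  finally have "ext_expectation P (Q z) = ereal v"
    using ext_expectation_ambiguity_set[OF assms(1) P assms(2), of "Q z"] assms(3) by simp
  then have "ereal v \<le> (SUP P \<in> ambiguity_set R \<mu>\<^sub>E \<mu>\<^sub>N. ext_expectation P (Q z))"
    using P by (metis SUP_upper)
  then show ?thesis
    unfolding dro_objective_def by (metis add_left_mono plus_ereal.simps(1))
qed

lemma dro_objective_eq_top:
  assumes "R > 0" "\<xi>\<^sub>0 \<in> half_disk R" "Q z \<xi>\<^sub>0 = \<infinity>" "(\<mu>\<^sub>E, \<mu>\<^sub>N) \<in> interior (half_disk R)"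
  shows "dro_objective q (ambiguity_set R \<mu>\<^sub>E \<mu>\<^sub>N) Q z = \<infinity>"
proof -
  let ?\<mu> = "(\<mu>\<^sub>E, \<mu>\<^sub>N)"
  obtain e where e: "e > 0" "cball ?\<mu> e \<subseteq> half_disk R"
    using assms(4) by (auto simp: mem_interior_cball)
  \<comment> \<open>As the mean is interior, it is a mixture of \<open>\<xi>\<^sub>0\<close>, with positive weight, and a second point
    \<open>\<xi>\<^sub>1\<close> of the support.\<close>
  define \<delta> where "\<delta> = e / (1 + norm (?\<mu> - \<xi>\<^sub>0))"
  have n: "1 + norm (?\<mu> - \<xi>\<^sub>0) > 0"
    by (simp add: add_pos_nonneg)
  then have "\<delta> > 0" using e by (simp add: \<delta>_def)
  define \<xi>\<^sub>1 where "\<xi>\<^sub>1 = ?\<mu> + \<delta> *\<^sub>R (?\<mu> - \<xi>\<^sub>0)"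
  have "\<delta> * norm (?\<mu> - \<xi>\<^sub>0) \<le> e"
    using e n by (simp add: \<delta>_def pos_divide_le_eq algebra_simps)
  then have "\<xi>\<^sub>1 \<in> half_disk R"
    using \<open>\<delta> > 0\<close> by (intro subsetD[OF e(2)]) (simp add: \<xi>\<^sub>1_def dist_norm)
  define u where "u = \<delta> / (1 + \<delta>)"
  have u: "0 < u" "u < 1" "1 - u = 1 / (1 + \<delta>)"
    using \<open>\<delta> > 0\<close> by (auto simp: u_def field_simps)
  have mean: "u *\<^sub>R \<xi>\<^sub>0 + (1 - u) *\<^sub>R \<xi>\<^sub>1 = ?\<mu>"
  proof -
    have "(1 + \<delta>) *\<^sub>R (u *\<^sub>R \<xi>\<^sub>0 + (1 - u) *\<^sub>R \<xi>\<^sub>1) = \<delta> *\<^sub>R \<xi>\<^sub>0 + \<xi>\<^sub>1"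
      unfolding u(3) using \<open>\<delta> > 0\<close> by (simp add: u_def scaleR_add_right)
    also have "\<dots> = (1 + \<delta>) *\<^sub>R ?\<mu>"
      by (simp add: \<xi>\<^sub>1_def scaleR_left_distrib scaleR_diff_right del: scaleR_Pair)
    finally show ?thesis
      using \<open>\<delta> > 0\<close> by (subst (asm) real_vector.scale_cancel_left) auto
  qed
  define p where "p = bernoulli_pmf u"
  define \<phi> where "\<phi> b = (if b then \<xi>\<^sub>0 else \<xi>\<^sub>1)" for b
  define P where "P = distr (measure_pmf p) borel \<phi>"
  have "measure_pmf.expectation p \<phi> = ?\<mu>"
    using u mean by (subst integral_measure_pmf[of UNIV]) (auto simp: p_def \<phi>_def UNIV_bool add.commute)
  then have P: "P \<in> ambiguity_set R \<mu>\<^sub>E \<mu>\<^sub>N"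
    unfolding P_def using assms(1,2) \<open>\<xi>\<^sub>1 \<in> half_disk R\<close>
    by (intro distr_pmf_in_ambiguity_set) (auto simp: \<phi>_def)
  have "0 < emeasure (measure_pmf p) {True}"
    using u by (simp add: emeasure_pmf_single p_def)
  \<comment> \<open>Only an inequality, since \<open>\<xi>\<^sub>1\<close> coincides with
    \<open>\<xi>\<^sub>0\<close> if \<open>\<xi>\<^sub>0\<close> is the mean.\<close>
  also have "\<dots> \<le> emeasure (measure_pmf p) (\<phi> -` {\<xi>\<^sub>0})"
    by (intro emeasure_mono) (auto simp: \<phi>_def)
  also have "\<dots> = emeasure P {\<xi>\<^sub>0}"
    by (simp add: P_def emeasure_distr)
  finally have "top * emeasure P {\<xi>\<^sub>0} = top"
    by (simp add: ennreal_top_mult)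
  then have "top = (\<integral>\<^sup>+\<xi>. top * indicator {\<xi>\<^sub>0} \<xi> \<partial>P)"
    by (subst nn_integral_cmult_indicator) (auto simp: P_def)
  also have "\<dots> \<le> (\<integral>\<^sup>+\<xi>. e2ennreal (Q z \<xi>) \<partial>P)"
    using assms(3) by (intro nn_integral_mono) (auto simp: indicator_def)
  finally have "(\<integral>\<^sup>+\<xi>. e2ennreal (Q z \<xi>) \<partial>P) = top"
    by (simp add: top_unique)
  \<comment> \<open>An infinite positive part decides, by the convention
    \<open>\<infinity> - \<infinity> = \<infinity>\<close>.\<close>
  then have "ext_expectation P (Q z) = \<infinity>"
    by (simp add: ext_expectation_def)
  then have "(SUP P \<in> ambiguity_set R \<mu>\<^sub>E \<mu>\<^sub>N. ext_expectation P (Q z)) = \<infinity>"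
    using P by (metis SUP_upper ereal_infty_less_eq(1))
  then show ?thesis
    by (simp add: dro_objective_def)
qed

text \<open>Under a distribution of total mass 1 the negative part integrates to
  \<open>\<infinity>\<close> and the positive part to 0.\<close>

lemma dro_objective_eq_bot:
  assumes "R > 0" "\<And>\<xi>. \<xi> \<in> half_disk R \<Longrightarrow> Q z \<xi> = - \<infinity>"
  shows "dro_objective q (ambiguity_set R \<mu>\<^sub>E \<mu>\<^sub>N) Q z = - \<infinity>"
proof -
  have "ext_expectation P (Q z) = - \<infinity>" if P: "P \<in> ambiguity_set R \<mu>\<^sub>E \<mu>\<^sub>N" for P
  proof -
    note D = ambiguity_setD[OF P assms(1)]
    interpret prob_space P by (rule D)
    have "AE \<xi> in P. Q z \<xi> = - \<infinity>"
      using D(2) by eventually_elim (rule assms(2))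
    then have "ext_expectation P (Q z) = ext_expectation P (\<lambda>_. - \<infinity>)"
      by (rule ext_expectation_cong_AE)
    then show ?thesis
      by (simp add: ext_expectation_def emeasure_space_1 e2ennreal_neg zero_ennreal.rep_eq)
  qed
  then have "(SUP P \<in> ambiguity_set R \<mu>\<^sub>E \<mu>\<^sub>N. ext_expectation P (Q z)) \<le> - \<infinity>"
    by (intro SUP_least) simp
  then show ?thesis
    by (simp add: dro_objective_def)
qed

section \<open>Strong duality for a fixed first-stage decision\<close>

text \<open>The three claims share one case split. An infeasible point makes both sides
  \<open>\<infinity>\<close> and unboundedness makes them \<open>- \<infinity>\<close>, for all
  multipliers. For finite values and a mean in the support, a distribution reaches
  \<open>q \<bullet> z + v\<close>, majorants push the dual infimum down to it, and weak duality
  closes the chain.\<close>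

lemma two_stage_duality_at:
  fixes A :: "real ^ 'n ^ 'm" and B :: "real \<times> real \<Rightarrow> real ^ 'k ^ 'm"
    and c :: "real ^ 'n" and d :: "real ^ 'm"
  defines "Q \<equiv> second_stage_value c A B d"
  assumes "R > 0" "affine_entries B"
    and feas: "(\<forall>\<xi>\<in>half_disk R. second_stage_feasible A B d z \<xi> \<noteq> {})
      \<or> (\<mu>\<^sub>E, \<mu>\<^sub>N) \<in> interior (half_disk R)"
  shows dro_objective_eq_INF: "dro_objective q (ambiguity_set R \<mu>\<^sub>E \<mu>\<^sub>N) Q z =
      (INF (l\<^sub>E, l\<^sub>N). minmaxmin_objective q \<mu>\<^sub>E \<mu>\<^sub>N (half_disk R) Q z l\<^sub>E l\<^sub>N)" (is "?dro = ?inf")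
    and dual_integrand_attains_max: "\<exists>\<xi>\<in>half_disk R. \<forall>\<xi>'\<in>half_disk R.
      dual_integrand Q z l\<^sub>E l\<^sub>N \<xi>' \<le> dual_integrand Q z l\<^sub>E l\<^sub>N \<xi>" (is ?max)
    and dro_objective_attained: "(\<mu>\<^sub>E, \<mu>\<^sub>N) \<in> interior (half_disk R) \<Longrightarrow>
      \<exists>l\<^sub>E l\<^sub>N. dro_objective q (ambiguity_set R \<mu>\<^sub>E \<mu>\<^sub>N) Q z =
        minmaxmin_objective q \<mu>\<^sub>E \<mu>\<^sub>N (half_disk R) Q z l\<^sub>E l\<^sub>N"
proof -
  let ?m = "minmaxmin_objective q \<mu>\<^sub>E \<mu>\<^sub>N (half_disk R) Q z"
  let ?int = "(\<mu>\<^sub>E, \<mu>\<^sub>N) \<in> interior (half_disk R)"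
  obtain \<xi>c where \<xi>c: "\<xi>c \<in> half_disk R"
    using half_disk_nonempty[OF \<open>R > 0\<close>] by auto
  have "?dro = ?inf \<and> ?max \<and> (?int \<longrightarrow> (\<exists>l\<^sub>E l\<^sub>N. ?dro = ?m l\<^sub>E l\<^sub>N))"
  proof (cases "\<exists>\<xi>\<in>half_disk R. second_stage_feasible A B d z \<xi> = {}")
    case True
    then obtain \<xi>\<^sub>0 where \<xi>\<^sub>0: "\<xi>\<^sub>0 \<in> half_disk R" "second_stage_feasible A B d z \<xi>\<^sub>0 = {}"
      by blast
    then have Q: "Q z \<xi>\<^sub>0 = \<infinity>"
      by (simp add: Q_def second_stage_value_def top_ereal_def)
    then have top: "dual_integrand Q z l\<^sub>E l\<^sub>N \<xi>\<^sub>0 = \<infinity>" for l\<^sub>E l\<^sub>N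
      by (simp add: dual_integrand_def)
    then have "(SUP \<xi>\<in>half_disk R. dual_integrand Q z l\<^sub>E l\<^sub>N \<xi>) = \<infinity>" for l\<^sub>E l\<^sub>N
      using \<xi>\<^sub>0(1) by (metis SUP_upper ereal_infty_less_eq(1))
    then have "?m l\<^sub>E l\<^sub>N = \<infinity>" for l\<^sub>E l\<^sub>N
      by (simp add: minmaxmin_objective_def)
    \<comment> \<open>The first alternative of \<open>feas\<close> fails at
      \<open>\<xi>\<^sub>0\<close>, so the mean is interior.\<close>
    moreover have "?dro = \<infinity>"
      using feas \<xi>\<^sub>0 Q \<open>R > 0\<close> by (intro dro_objective_eq_top) auto
    moreover have ?max
      using \<xi>\<^sub>0(1) top by (intro bexI[of _ \<xi>\<^sub>0]) auto
    ultimately show ?thesis by simp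
  next
    case False
    then have ne: "second_stage_feasible A B d z \<xi> \<noteq> {}" if "\<xi> \<in> half_disk R" for \<xi>
      using that by blast
    show ?thesis
    proof (rule second_stage_value_cases[OF \<open>affine_entries B\<close>, of A d z c])
      assume unbounded: "\<And>\<xi>. second_stage_feasible A B d z \<xi> \<noteq> {} \<Longrightarrow>
        second_stage_value c A B d z \<xi> = - \<infinity>"
      with ne have Q: "Q z \<xi> = - \<infinity>" if "\<xi> \<in> half_disk R" for \<xi>
        using that by (simp add: Q_def)
      then have bot: "dual_integrand Q z l\<^sub>E l\<^sub>N \<xi> = - \<infinity>" if "\<xi> \<in> half_disk R" for l\<^sub>E l\<^sub>N \<xi>
        using that by (simp add: dual_integrand_def)
      then have "(SUP \<xi>\<in>half_disk R. dual_integrand Q z l\<^sub>E l\<^sub>N \<xi>) \<le> - \<infinity>" for l\<^sub>E l\<^sub>N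
        by (intro SUP_least) simp
      then have "?m l\<^sub>E l\<^sub>N = - \<infinity>" for l\<^sub>E l\<^sub>N
        by (simp add: minmaxmin_objective_def)
      moreover have "?dro = - \<infinity>"
        using Q \<open>R > 0\<close> by (rule dro_objective_eq_bot[rotated])
      moreover have ?max
        using \<xi>c bot by (intro bexI[of _ \<xi>c]) auto
      ultimately show ?thesis by simp
    next
      fix g
      assume bounded: "continuous_on UNIV g" "\<And>\<xi>. second_stage_feasible A B d z \<xi> \<noteq> {} \<Longrightarrow>
        second_stage_value c A B d z \<xi> = ereal (g \<xi>)"
      with ne have Q: "Q z \<xi> = ereal (g \<xi>)" if "\<xi> \<in> half_disk R" for \<xi>
        using that by (simp add: Q_def)
      note K = compact_half_disk[OF \<open>R > 0\<close>] half_disk_nonempty[OF \<open>R > 0\<close>]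
      have cont: "continuous_on (half_disk R) g"
        using bounded(1) by (rule continuous_on_subset) simp
      have ?max
      proof -
        have "continuous_on (half_disk R) (\<lambda>\<xi>. g \<xi> - l\<^sub>E * fst \<xi> - l\<^sub>N * snd \<xi>)"
          using cont by (intro continuous_intros)
        from continuous_attains_sup[OF K this] show ?thesis
          by (auto simp: dual_integrand_def Q)
      qed
      moreover have weak: "?dro \<le> ?m l\<^sub>E l\<^sub>N" for l\<^sub>E l\<^sub>N
        using \<open>R > 0\<close> bounded(1) Q by (rule weak_duality)
      have le_inf: "?dro \<le> ?inf"
        using weak by (auto intro!: INF_greatest)
      have inf_le: "?inf \<le> ereal (q \<bullet> z + t)"
        if "\<exists>l. \<forall>\<xi>\<in>half_disk R. g \<xi> - l \<bullet> \<xi> \<le> t - l \<bullet> (\<mu>\<^sub>E, \<mu>\<^sub>N)" for t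
      proof -
        from that obtain l where "\<And>\<xi>. \<xi> \<in> half_disk R \<Longrightarrow> g \<xi> - l \<bullet> \<xi> \<le> t - l \<bullet> (\<mu>\<^sub>E, \<mu>\<^sub>N)"
          by blast
        then have "?m (fst l) (snd l) \<le> ereal (q \<bullet> z + t)"
          using Q by (intro minmaxmin_objective_le)
        then show ?thesis
          by (intro INF_lower2[of l]) (auto simp: case_prod_beta)
      qed
      have "?inf \<le> ?dro \<and> (?int \<longrightarrow> (\<exists>l\<^sub>E l\<^sub>N. ?dro = ?m l\<^sub>E l\<^sub>N))"
      proof (cases "(\<mu>\<^sub>E, \<mu>\<^sub>N) \<in> half_disk R")
        case True
        obtain v where v: "((\<mu>\<^sub>E, \<mu>\<^sub>N), v) \<in> convex hull ((\<lambda>\<xi>. (\<xi>, g \<xi>)) ` half_disk R)"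
            "\<And>t. t > v \<Longrightarrow> \<exists>l. \<forall>\<xi>\<in>half_disk R. g \<xi> - l \<bullet> \<xi> \<le> t - l \<bullet> (\<mu>\<^sub>E, \<mu>\<^sub>N)"
            "?int \<Longrightarrow> \<exists>l. \<forall>\<xi>\<in>half_disk R. g \<xi> - l \<bullet> \<xi> \<le> v - l \<bullet> (\<mu>\<^sub>E, \<mu>\<^sub>N)"
          by (rule affine_majorant_at_concave_envelope[OF K(1) cont True]) blast
        have ge: "ereal (q \<bullet> z + v) \<le> ?dro"
          using \<open>R > 0\<close> bounded(1) Q v(1) by (rule dro_objective_ge_envelope)
        have "?inf \<le> ereal (q \<bullet> z + v)"
        \<comment> \<open>Majorants are taken at \<open>t = v + e\<close>, as at a boundary mean no
          multiplier need reach \<open>v\<close> itself.\<close>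
        proof (rule ereal_le_epsilon2)
          fix e :: real assume "e > 0"
          then have "?inf \<le> ereal (q \<bullet> z + (v + e))"
            by (intro inf_le v(2)) simp
          then show "?inf \<le> ereal (q \<bullet> z + v) + ereal e"
            by (simp add: add.assoc)
        qed
        moreover have "\<exists>l\<^sub>E l\<^sub>N. ?dro = ?m l\<^sub>E l\<^sub>N" if int: ?int
        proof -
          obtain l where "\<And>\<xi>. \<xi> \<in> half_disk R \<Longrightarrow> g \<xi> - l \<bullet> \<xi> \<le> v - l \<bullet> (\<mu>\<^sub>E, \<mu>\<^sub>N)"
            using v(3)[OF int] by blast
          then have "?m (fst l) (snd l) \<le> ereal (q \<bullet> z + v)"
            using Q by (intro minmaxmin_objective_le)
          then show ?thesis
            using weak ge by (meson antisym order_trans)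
        qed
        ultimately show ?thesis
          using ge by (auto intro: order_trans)
      next
        case False
        \<comment> \<open>Outside the support majorants exist at every height; the height
          \<open>t - q \<bullet> z\<close> makes the bound exactly \<open>t\<close>.\<close>
        have "?inf \<le> ereal t" for t
          using inf_le[of "t - q \<bullet> z"]
            affine_majorant_outside[OF K(1) convex_half_disk[OF \<open>R > 0\<close>] K(2) cont False] by simp
        \<comment> \<open>Here the ambiguity set is empty; weak duality then yields \<open>?dro = - \<infinity>\<close> as well.\<close>
        then have "?inf = - \<infinity>"
          by (simp add: ereal_bot)
        moreover have "\<not> ?int"
          using False interior_subset by blast
        ultimately show ?thesis by simp
      qed
      ultimately show ?thesis
        using le_inf by auto
    qed
  qed
  then show "?dro = ?inf" ?max "?int \<Longrightarrow> \<exists>l\<^sub>E l\<^sub>N. ?dro = ?m l\<^sub>E l\<^sub>N"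
    by blast+
qed

section \<open>Joint minimization over decisions and multipliers\<close>

text \<open>Feasibility or an interior mean is assumed because at a boundary mean the admissible
  distributions may all avoid an infeasible point of the support: the left side can then be finite
  while every dual value is \<open>\<infinity>\<close>.\<close>

theorem mainTheorem1:
  fixes R \<mu>\<^sub>E \<mu>\<^sub>N :: real
    and q :: "real ^ 'k" and c :: "real ^ 'n" and A :: "real ^ 'n ^ 'm" and d :: "real ^ 'm"
    and B :: "real \<times> real \<Rightarrow> real ^ 'k ^ 'm"
    and F :: "(real ^ 'k) set"
  defines "\<Xi> \<equiv> half_disk R"
    and "\<D> \<equiv> ambiguity_set R \<mu>\<^sub>E \<mu>\<^sub>N"
    and "Q \<equiv> second_stage_value c A B d"
  assumes "R > 0"
    and "affine_entries B"
    and "(\<forall>z\<in>F. \<forall>\<xi>\<in>\<Xi>. second_stage_feasible A B d z \<xi> \<noteq> {}) \<or> (\<mu>\<^sub>E, \<mu>\<^sub>N) \<in> interior \<Xi>"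
  shows
    "(INF z\<in>F. dro_objective q \<D> Q z) =
       (INF (z, l\<^sub>E, l\<^sub>N) \<in> F \<times> UNIV \<times> UNIV. minmaxmin_objective q \<mu>\<^sub>E \<mu>\<^sub>N \<Xi> Q z l\<^sub>E l\<^sub>N)
     \<and> (\<forall>z\<in>F. dro_objective q \<D> Q z =
          (INF (l\<^sub>E, l\<^sub>N) \<in> UNIV. minmaxmin_objective q \<mu>\<^sub>E \<mu>\<^sub>N \<Xi> Q z l\<^sub>E l\<^sub>N))
     \<and> (\<forall>z\<in>F. \<forall>l\<^sub>E l\<^sub>N. \<exists>\<xi>\<in>\<Xi>. \<forall>\<xi>'\<in>\<Xi>.
          dual_integrand Q z l\<^sub>E l\<^sub>N \<xi>' \<le> dual_integrand Q z l\<^sub>E l\<^sub>N \<xi>)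
     \<and> ((\<mu>\<^sub>E, \<mu>\<^sub>N) \<in> interior \<Xi> \<longrightarrow>
          (\<forall>z\<in>F. \<exists>l\<^sub>E l\<^sub>N. dro_objective q \<D> Q z = minmaxmin_objective q \<mu>\<^sub>E \<mu>\<^sub>N \<Xi> Q z l\<^sub>E l\<^sub>N))"
proof -
  let ?m = "minmaxmin_objective q \<mu>\<^sub>E \<mu>\<^sub>N \<Xi> Q"
  have feas: "(\<forall>\<xi>\<in>half_disk R. second_stage_feasible A B d z \<xi> \<noteq> {})
      \<or> (\<mu>\<^sub>E, \<mu>\<^sub>N) \<in> interior (half_disk R)" if "z \<in> F" for z
    using assms(6) that unfolding \<Xi>_def by blast
  note duality = two_stage_duality_at[OF assms(4,5) feas, where c = c, folded \<Xi>_def \<D>_def Q_def]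
  have "(INF z\<in>F. dro_objective q \<D> Q z) = (INF z\<in>F. INF l. ?m z (fst l) (snd l))"
    by (intro INF_cong refl) (simp add: duality(1) case_prod_beta)
  also have "\<dots> = (INF (z, l\<^sub>E, l\<^sub>N) \<in> F \<times> UNIV \<times> UNIV. ?m z l\<^sub>E l\<^sub>N)"
  proof (rule antisym)
    show "(INF z\<in>F. INF l. ?m z (fst l) (snd l)) \<le> (INF (z, l\<^sub>E, l\<^sub>N) \<in> F \<times> UNIV \<times> UNIV. ?m z l\<^sub>E l\<^sub>N)"
    proof (rule INF_greatest, clarify)
      fix z and l\<^sub>E l\<^sub>N :: real assume "z \<in> F"
      then show "(INF z\<in>F. INF l. ?m z (fst l) (snd l)) \<le> ?m z l\<^sub>E l\<^sub>N"
        by (intro INF_lower2[of z] INF_lower2[of "(l\<^sub>E, l\<^sub>N)"]) auto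
    qed
    show "(INF (z, l\<^sub>E, l\<^sub>N) \<in> F \<times> UNIV \<times> UNIV. ?m z l\<^sub>E l\<^sub>N) \<le> (INF z\<in>F. INF l. ?m z (fst l) (snd l))"
    proof (intro INF_greatest)
      fix z and l :: "real \<times> real" assume "z \<in> F"
      then show "(INF (z, l\<^sub>E, l\<^sub>N) \<in> F \<times> UNIV \<times> UNIV. ?m z l\<^sub>E l\<^sub>N) \<le> ?m z (fst l) (snd l)"
        by (intro INF_lower2[of "(z, fst l, snd l)"]) (auto simp: case_prod_beta)
    qed
  qed
  finally show ?thesis
    using duality by blast
qed

end
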